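(* Let $\varepsilon\in(0,1)$ be a constant and let $p=p(n)\in[0,1]$ satisfy $p\gg n^{-\varepsilon}$, i.e. $p(n)\,n^{\varepsilon}\to\infty$ as $n\to\infty$. Let $G=G(n,p)$ be a random graph and let $\Delta$ denote the maximum degree of $G$. Then a.a.s. $\chi'_{\rm CF}(G)\leq \log_2\Delta+O(\log_2\log_2\Delta)=(1+o(1))\log_2\Delta$. That is, there is a constant $C$ such that, with probability tending to $1$ as $n\to\infty$, $G$ has no isolated vertices and $\chi'_{\rm CF}(G)\leq \log_2\Delta+C\log_2\log_2\Delta$; in particular, for every $\eta>0$, with probability tending to $1$ as $n\to\infty$, $\chi'_{\rm CF}(G)\leq(1+\eta)\log_2\Delta$.
   Context: $G(n,p)$ is the random graph on $n$ labeled vertices in which each potential edge appears independently with probability $p$. "A.a.s." means with probability tending to $1$ as $n\to\infty$. For a finite simple graph $G=(V,E)$ without isolated vertices, an edge coloring $c$ of $G$ is any assignment of colors to the edges of $G$ (not necessarily proper). For a vertex $v$, $E_G(v)$ denotes the set of edges of $G$ incident with $v$. For an edge $uv\in E$, its closed neighborhood is $E_G[uv]=E_G(u)\cup E_G(v)$ (so it contains $uv$ itself). An edge $uv$ is satisfied by $c$ if some color appears exactly once on the edges of $E_G[uv]$. The coloring $c$ of $E$ is conflict-free if every edge of $G$ is satisfied. The conflict-free chromatic index $\chi'_{\rm CF}(G)$ (defined for graphs without isolated vertices) is the least number of colors in a conflict-free edge coloring of $G$. *)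

theory Defs
  imports "HOL-Probability.Probability"
begin

text \<open>A graph is a pair of a vertex set and a set of edges, each edge being a
  two-element set of vertices.\<close>

type_synonym 'a graph = "'a set \<times> 'a set set"

abbreviation verts :: "'a graph \<Rightarrow> 'a set" where
  "verts G \<equiv> fst G"

abbreviation edges :: "'a graph \<Rightarrow> 'a set set" where
  "edges G \<equiv> snd G"

definition all_edges :: "'a set \<Rightarrow> 'a set set" where
  "all_edges V = {e. e \<subseteq> V \<and> card e = 2}"

definition simple_graph :: "'a graph \<Rightarrow> bool" where
  "simple_graph G \<longleftrightarrow> finite (verts G) \<and> edges G \<subseteq> all_edges (verts G)"

definition incident_edges :: "'a graph \<Rightarrow> 'a \<Rightarrow> 'a set set" where
  "incident_edges G v = {e \<in> edges G. v \<in> e}"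

definition degree :: "'a graph \<Rightarrow> 'a \<Rightarrow> nat" where
  "degree G v = card (incident_edges G v)"

definition max_degree :: "'a graph \<Rightarrow> nat" where
  "max_degree G = Max (degree G ` verts G)"

definition no_isolated_vertices :: "'a graph \<Rightarrow> bool" where
  "no_isolated_vertices G \<longleftrightarrow> (\<forall>v \<in> verts G. incident_edges G v \<noteq> {})"

definition closed_edge_nbhd :: "'a graph \<Rightarrow> 'a set \<Rightarrow> 'a set set" where
  "closed_edge_nbhd G e = (\<Union>v\<in>e. incident_edges G v)"

definition satisfied :: "'a graph \<Rightarrow> ('a set \<Rightarrow> 'c) \<Rightarrow> 'a set \<Rightarrow> bool" where
  "satisfied G c e \<longleftrightarrow> (\<exists>a. \<exists>!f. f \<in> closed_edge_nbhd G e \<and> c f = a)"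

definition conflict_free :: "'a graph \<Rightarrow> ('a set \<Rightarrow> 'c) \<Rightarrow> bool" where
  "conflict_free G c \<longleftrightarrow> (\<forall>e \<in> edges G. satisfied G c e)"

text \<open>Natural numbers serve as colours, which is no restriction for finite graphs. Only the
  values of a colouring on the edges matter, and the colours used are those in its image.\<close>

definition cf_chromatic_index :: "'a graph \<Rightarrow> nat" where
  "cf_chromatic_index G =
    (LEAST k. \<exists>c :: 'a set \<Rightarrow> nat. conflict_free G c \<and> card (c ` edges G) = k)"

definition random_graph :: "nat \<Rightarrow> real \<Rightarrow> nat graph pmf" where
  "random_graph n p =
    map_pmf (\<lambda>X. ({1..n}, {e \<in> all_edges {1..n}. X e}))
      (Pi_pmf (all_edges {1..n}) False (\<lambda>_. bernoulli_pmf p))"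

lemma simple_graph_random_graph:
  "G \<in> set_pmf (random_graph n p) \<Longrightarrow> simple_graph G"
  by (auto simp: random_graph_def simple_graph_def)

text \<open>The minimum defining the index is attained, so it is not an unspecified value.\<close>

lemma cf_chromatic_index_attained:
  assumes "simple_graph G"
  shows "\<exists>c :: 'a set \<Rightarrow> nat. conflict_free G c \<and> card (c ` edges G) = cf_chromatic_index G"
proof -
  have "finite (all_edges (verts G))"
    using assms by (auto simp: all_edges_def simple_graph_def)
  then have "finite (edges G)"
    using assms by (auto simp: simple_graph_def intro: finite_subset)
  then obtain c :: "'a set \<Rightarrow> nat" where c: "inj_on c (edges G)"
    using finite_imp_inj_to_nat_seg by blast
  have "satisfied G c e" if e: "e \<in> edges G" for e
  proof -
    have "e \<noteq> {}"
      using assms e by (auto simp: simple_graph_def all_edges_def)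
    then have "e \<in> closed_edge_nbhd G e"
      using e by (auto simp: closed_edge_nbhd_def incident_edges_def)
    moreover have "f = e" if "f \<in> closed_edge_nbhd G e" "c f = c e" for f
      using that e c by (auto simp: closed_edge_nbhd_def incident_edges_def dest: inj_onD)
    ultimately show ?thesis
      unfolding satisfied_def by blast
  qed
  then have "\<exists>k. \<exists>c :: 'a set \<Rightarrow> nat. conflict_free G c \<and> card (c ` edges G) = k"
    by (auto simp: conflict_free_def)
  then show ?thesis
    unfolding cf_chromatic_index_def by (rule LeastI_ex)
qed

end

theory Submission
  imports Defs "HOL-Real_Asymp.Real_Asymp"
begin

text \<open>Suppose the vertices of a graph are coloured properly by nonempty subsets \<open>S v\<close> of a palette,
and suppose that every \<open>v\<close> could own, for each colour in \<open>S v\<close>, exactly one edge of that colour.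
Then an edge \<open>uv\<close> is satisfied by any colour in which \<open>S u\<close> and \<open>S v\<close> differ. A palette of size
\<open>log\<^sub>2 (\<Delta> + 2)\<close>, rounded up, has enough nonempty subsets for a greedy proper colouring, which is
where the leading term \<open>log\<^sub>2 \<Delta>\<close> comes from. The difficulty is that the owned edges have a second
endpoint, whose view of the palette they spoil.

The remedy is to split the vertex set into three parts arranged in a cycle, each with its own
palette, and to let each vertex own edges leading into the next part only. The palette of a part
is then seen in that part and the next one but never in the previous one. Hence an edge inside a
part is satisfied by a colour in the symmetric difference of the two sets, and an edge between
two parts is satisfied by a colour owned by its endpoint in the later part, since the other
endpoint does not meet that palette at all; three is the length of a cycle in which any two
distinct parts are consecutive. All remaining edges share one further colour. Only the
degrees inside the parts matter for the sizes of the palettes, and only as many neighbours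
in the next part as there are colours are required
(\<open>cf_chromatic_index_le_cyclic_tripartition\<close>).

In the random graph, two of the parts can be chosen so small that every vertex has only polylogarithmic
degree into them, but still has at least \<open>k \<approx> log\<^sub>2 n\<close> neighbours in each of
them that does not contain it: each is the union of \<open>k\<close> disjoint blocks of about \<open>3 k
/ p\<close> vertices. A vertex outside a given block has no neighbour in it with probability at most
\<open>exp (- 3 k) \<le> n powr - 3\<close>, so that a.a.s. every vertex has a neighbour in every block
not containing it (\<open>prob_not_hits_blocks\<close>), and an exponential moment bounds the degrees
into the small parts by \<open>18 k\<^sup>2\<close> (\<open>prob_not_sparse_into\<close>). The two small
palettes then have size \<open>2 log\<^sub>2 k + O(1)\<close> each. Cutting all of \<open>{1..n}\<close>
into blocks also shows that all degrees are at least about \<open>n p / (4 k)\<close>, a positive power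
of \<open>n\<close>; therefore \<open>log\<^sub>2 k\<close> is at most \<open>log\<^sub>2 (log\<^sub>2
\<Delta>) + O(1)\<close>, no vertex is isolated, and \<open>C = 5\<close> suffices.\<close>

section \<open>Conflict-free colourings from cyclic tripartitions\<close>

definition neighbours :: "'a graph \<Rightarrow> 'a \<Rightarrow> 'a set" where
  "neighbours G v = {w \<in> verts G. {v, w} \<in> edges G}"

lemma degree_eq_card_neighbours:
  assumes "simple_graph G"
  shows "degree G v = card (neighbours G v)"
proof -
  have edge: "e \<in> edges G \<Longrightarrow> e \<subseteq> verts G \<and> card e = 2" for e
    using assms by (auto simp: simple_graph_def all_edges_def)
  have "incident_edges G v = (\<lambda>w. {v, w}) ` neighbours G v"
  proof (intro equalityI subsetI)
    fix e assume e: "e \<in> incident_edges G v"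
    then obtain x y where xy: "e = {x, y}"
      using edge[of e] by (auto simp: incident_edges_def card_2_iff)
    then show "e \<in> (\<lambda>w. {v, w}) ` neighbours G v"
      using e edge[of e]
      by (auto simp: incident_edges_def neighbours_def doubleton_eq_iff image_iff insert_commute)
  qed (auto simp: incident_edges_def neighbours_def)
  moreover have "inj_on (\<lambda>w. {v, w}) (neighbours G v)"
    by (auto simp: inj_on_def doubleton_eq_iff)
  ultimately show ?thesis
    by (simp add: degree_def card_image)
qed

text \<open>Colouring the vertices one at a time, each finds on its list a colour that none of its
neighbours has taken. Lists are what allows the three parts to be coloured at once, each from
the subsets of its own palette.\<close>
lemma greedy_list_colouring:
  assumes "finite V" and "symp R"
    and "\<And>v. v \<in> V \<Longrightarrow> card {w \<in> V. R v w} < card (L v)"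
  shows "\<exists>f. (\<forall>v\<in>V. f v \<in> L v) \<and> (\<forall>v\<in>V. \<forall>w\<in>V. v \<noteq> w \<longrightarrow> R v w \<longrightarrow> f v \<noteq> f w)"
  using assms(1,3)
proof (induction V rule: finite_induct)
  case empty
  then show ?case by simp
next
  case (insert x V)
  have "\<exists>f. (\<forall>v\<in>V. f v \<in> L v) \<and> (\<forall>v\<in>V. \<forall>w\<in>V. v \<noteq> w \<longrightarrow> R v w \<longrightarrow> f v \<noteq> f w)"
  proof (rule insert.IH)
    fix v assume "v \<in> V"
    have "card {w \<in> V. R v w} \<le> card {w \<in> insert x V. R v w}"
      using insert.hyps(1) by (intro card_mono) auto
    also have "\<dots> < card (L v)"
      using insert.prems[of v] \<open>v \<in> V\<close> by simp
    finally show "card {w \<in> V. R v w} < card (L v)" .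
  qed
  then obtain f where f: "\<forall>v\<in>V. f v \<in> L v"
    "\<forall>v\<in>V. \<forall>w\<in>V. v \<noteq> w \<longrightarrow> R v w \<longrightarrow> f v \<noteq> f w"
    by (elim exE conjE) (rule that)
  have "card (f ` {w \<in> V. R x w}) \<le> card {w \<in> insert x V. R x w}"
    using insert.hyps(1)
    by (intro order_trans[OF card_image_le card_mono]) auto
  also have "\<dots> < card (L x)"
    using insert.prems[of x] by simp
  finally have "\<not> L x \<subseteq> f ` {w \<in> V. R x w}"
    using insert.hyps(1) card_mono[of "f ` {w \<in> V. R x w}" "L x"] by auto
  then obtain a where a: "a \<in> L x" "a \<notin> f ` {w \<in> V. R x w}"
    by blast
  have "R v x \<Longrightarrow> R x v" for v
    using assms(2) by (auto dest: sympD)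
  then show ?case
    using f a insert.hyps(2) by (intro exI[of _ "f(x := a)"]) auto
qed

text \<open>Each vertex \<open>v\<close> receives a nonempty set \<open>S v\<close> of colours from the palette of its part, different from
the sets of its neighbours in the same part, and sends for each \<open>i \<in> S v\<close> one edge of colour \<open>i\<close> to
its own \<open>i\<close>-th target \<open>g v i\<close> in the next part. From the viewpoint of \<open>v\<close>, a colour of
its own palette appears once or never according to \<open>S v\<close>, because the edges of these colours that it
does not send arrive in the next part; vertices of the previous part meet none of them. The \<open>- 1\<close> in the last
hypothesis accounts for the empty set, which must be avoided for the edges between parts.\<close>
lemma cf_chromatic_index_le_cyclic_tripartition:
  fixes G :: "'a graph" and part :: "'a \<Rightarrow> nat" and P :: "nat \<Rightarrow> nat"
  assumes simple: "simple_graph G"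
    and part: "\<And>v. v \<in> verts G \<Longrightarrow> part v < 3"
    and targets: "\<And>v. v \<in> verts G \<Longrightarrow>
      P (part v) \<le> card {w \<in> neighbours G v. part w = Suc (part v) mod 3}"
    and sparse: "\<And>v. v \<in> verts G \<Longrightarrow>
      card {w \<in> neighbours G v. part w = part v} < 2 ^ P (part v) - 1"
  shows "cf_chromatic_index G \<le> Suc (\<Sum>j<3. P j)"
proof -
  let ?V = "verts G" and ?E = "edges G"
  have finV: "finite ?V"
    using simple by (simp add: simple_graph_def)
  have edge: "\<exists>x y. e = {x, y} \<and> x \<noteq> y \<and> x \<in> ?V \<and> y \<in> ?V" if "e \<in> ?E" for e
  proof -
    from that have "e \<subseteq> ?V" "card e = 2"
      using simple by (auto simp: simple_graph_def all_edges_def)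
    then show ?thesis
      unfolding card_2_iff by blast
  qed
  define R where "R v w \<longleftrightarrow> {v, w} \<in> ?E \<and> part v = part w" for v w
  define L where "L v = Pow {..<P (part v)} - {{}}" for v
  have "\<exists>S. (\<forall>v\<in>?V. S v \<in> L v) \<and> (\<forall>v\<in>?V. \<forall>w\<in>?V. v \<noteq> w \<longrightarrow> R v w \<longrightarrow> S v \<noteq> S w)"
  proof (rule greedy_list_colouring[OF finV])
    show "symp R"
      by (auto simp: symp_def R_def insert_commute)
    fix v assume v: "v \<in> ?V"
    have "{w \<in> ?V. R v w} = {w \<in> neighbours G v. part w = part v}"
      by (auto simp: R_def neighbours_def)
    moreover have "card (L v) = 2 ^ P (part v) - 1"
      by (simp add: L_def card_Pow card_Diff_singleton)
    ultimately show "card {w \<in> ?V. R v w} < card (L v)"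
      using sparse[OF v] by simp
  qed
  then obtain S where S: "\<forall>v\<in>?V. S v \<in> L v"
    "\<forall>v\<in>?V. \<forall>w\<in>?V. v \<noteq> w \<longrightarrow> R v w \<longrightarrow> S v \<noteq> S w"
    by (elim exE conjE) (rule that)
  have S_palette: "i < P (part v)" if "v \<in> ?V" "i \<in> S v" for v i
    using S(1) that by (auto simp: L_def)
  have S_nonempty: "S v \<noteq> {}" if "v \<in> ?V" for v
    using S(1) that by (auto simp: L_def)
  have S_proper: "S v \<noteq> S w"
    if "v \<in> ?V" "w \<in> ?V" "v \<noteq> w" "{v, w} \<in> ?E" "part v = part w" for v w
    using S(2) that by (auto simp: R_def)
  define T where "T v = {w \<in> neighbours G v. part w = Suc (part v) mod 3}" for v
  have "\<forall>v\<in>?V. \<exists>h. h ` {..<P (part v)} \<subseteq> T v \<and> inj_on h {..<P (part v)}"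
  proof
    fix v assume v: "v \<in> ?V"
    have "finite (T v)"
      using finV by (simp add: T_def neighbours_def)
    then show "\<exists>h. h ` {..<P (part v)} \<subseteq> T v \<and> inj_on h {..<P (part v)}"
      using targets[OF v] by (intro card_le_inj) (simp_all add: T_def)
  qed
  from bchoice[OF this] obtain g where
    g: "\<forall>v\<in>?V. g v ` {..<P (part v)} \<subseteq> T v \<and> inj_on (g v) {..<P (part v)}"
    by (rule exE)
  have g_edge: "{v, g v i} \<in> ?E" "g v i \<in> ?V" "part (g v i) = Suc (part v) mod 3"
    if "v \<in> ?V" "i \<in> S v" for v i
    using bspec[OF g that(1)] S_palette[OF that]
    by (auto simp: T_def neighbours_def image_subset_iff)
  have g_inj: "i = i'" if "v \<in> ?V" "i \<in> S v" "i' \<in> S v" "g v i = g v i'" for v i i'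
    using bspec[OF g that(1)] S_palette[OF that(1)] that by (auto dest: inj_onD)
  have next_neq: "Suc (part v) mod 3 \<noteq> part v" "Suc (Suc (part v) mod 3) mod 3 \<noteq> part v"
    if "v \<in> ?V" for v
  proof -
    have "part v = 0 \<or> part v = 1 \<or> part v = 2"
      using part[OF that] by linarith
    then show "Suc (part v) mod 3 \<noteq> part v" "Suc (Suc (part v) mod 3) mod 3 \<noteq> part v"
      by auto
  qed
  define sent where "sent e ji \<longleftrightarrow>
    (\<exists>v\<in>?V. \<exists>i\<in>S v. ji = (part v, i) \<and> e = {v, g v i})" for e ji
  \<comment> \<open>No edge is sent twice: if both endpoints sent it, two steps along the cycle of
    length three would lead back to the start.\<close>
  have sent_unique: "ji = ji'" if "sent e ji" "sent e ji'" for e ji ji'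
  proof -
    obtain v i where v: "v \<in> ?V" "i \<in> S v" "ji = (part v, i)" "e = {v, g v i}"
      using \<open>sent e ji\<close> by (auto simp: sent_def)
    obtain v' i' where v': "v' \<in> ?V" "i' \<in> S v'" "ji' = (part v', i')" "e = {v', g v' i'}"
      using \<open>sent e ji'\<close> by (auto simp: sent_def)
    from v(4) v'(4) consider "v = v'" "g v i = g v' i'" | "v = g v' i'" "v' = g v i"
      by (auto simp: doubleton_eq_iff)
    then show ?thesis
    proof cases
      case 1
      then show ?thesis
        using g_inj[of v i i'] v(1-3) v'(2,3) by simp
    next
      case 2
      then have "part v = Suc (part v') mod 3" "part v' = Suc (part v) mod 3"
        using g_edge(3)[OF v(1,2)] g_edge(3)[OF v'(1,2)] by simp_all
      then show ?thesis
        using next_neq(2)[OF v(1)] by simp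
    qed
  qed
  have sent_own: "e = {u, g u i} \<and> i \<in> S u"
    if "u \<in> ?V" "u \<in> e" "sent e (part u, i)" for u e i
    using that g_edge(3) next_neq(1) by (fastforce simp: sent_def)
  have sent_part: "part u = j \<or> part u = Suc j mod 3"
    if "u \<in> e" "sent e (j, i)" for u e j i
    using that g_edge(3) by (auto simp: sent_def)
  \<comment> \<open>Edges that nobody sends share the colour 0.\<close>
  define c :: "'a set \<Rightarrow> nat" where
    "c e = (if \<exists>ji. sent e ji then Suc (prod_encode (THE ji. sent e ji)) else 0)" for e
  have c_sent: "c e = Suc (prod_encode ji) \<longleftrightarrow> sent e ji" for e ji
  proof (cases "\<exists>ji. sent e ji")
    case True
    then obtain ji' where ji': "sent e ji'" by blast
    then have "(THE ji. sent e ji) = ji'"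
      using sent_unique by blast
    then have "c e = Suc (prod_encode ji')"
      using True unfolding c_def by simp
    moreover have "sent e ji \<longleftrightarrow> ji = ji'"
      using ji' sent_unique by blast
    ultimately show ?thesis
      by (auto simp: prod_encode_eq)
  next
    case False
    then show ?thesis
      unfolding c_def by (metis nat.distinct(1))
  qed
  \<comment> \<open>The colour \<open>i\<close> of the palette of \<open>u\<close> occurs exactly once at \<open>u\<close>, so it satisfies \<open>ux\<close> as soon as
    \<open>x\<close> meets no other edge of that colour.\<close>
  have satisfied_by: "satisfied G c {u, x}"
    if u: "u \<in> ?V" "i \<in> S u"
      and x: "\<And>f. x \<in> f \<Longrightarrow> sent f (part u, i) \<Longrightarrow> f = {u, g u i}"
    for u x i
    unfolding satisfied_def
  proof (intro exI ex1I)
    show "{u, g u i} \<in> closed_edge_nbhd G {u, x} \<and>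
        c {u, g u i} = Suc (prod_encode (part u, i))"
      using u g_edge(1) by (auto simp: closed_edge_nbhd_def incident_edges_def c_sent sent_def)
    fix f assume "f \<in> closed_edge_nbhd G {u, x} \<and> c f = Suc (prod_encode (part u, i))"
    then have "u \<in> f \<or> x \<in> f" "sent f (part u, i)"
      by (auto simp: closed_edge_nbhd_def incident_edges_def c_sent)
    then show "f = {u, g u i}"
      using x[of f] sent_own[OF u(1), of f i] by blast
  qed
  have "satisfied G c {u, x}" if e: "{u, x} \<in> ?E" "u \<noteq> x" "u \<in> ?V" "x \<in> ?V" for u x
  proof -
    have sym: "satisfied G c {x, u} \<Longrightarrow> satisfied G c {u, x}"
      by (simp add: insert_commute)
    have "part u = part x \<or> part x = Suc (part u) mod 3 \<or> part u = Suc (part x) mod 3"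
    proof -
      have "part u = 0 \<or> part u = 1 \<or> part u = 2" "part x = 0 \<or> part x = 1 \<or> part x = 2"
        using part[OF e(3)] part[OF e(4)] by linarith+
      then show ?thesis by auto
    qed
    then consider "part u = part x" | "part x = Suc (part u) mod 3" | "part u = Suc (part x) mod 3"
      by blast
    then show ?thesis
    proof cases
      case 1
      then have "S u \<noteq> S x"
        using S_proper[OF e(3,4,2,1)] by blast
      then consider i where "i \<in> S u" "i \<notin> S x" | i where "i \<in> S x" "i \<notin> S u"
        by blast
      then show ?thesis
      proof cases
        case (1 i)
        then show ?thesis
          using satisfied_by[OF e(3) \<open>i \<in> S u\<close>, of x] sent_own[OF e(4), of _ i] \<open>part u = part x\<close>
          by auto
      next
        case (2 i)
        then show ?thesis
          using satisfied_by[OF e(4) \<open>i \<in> S x\<close>, of u] sent_own[OF e(3), of _ i] \<open>part u = part x\<close>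
          by (intro sym) auto
      qed
    next
      case 2
      obtain i where "i \<in> S x"
        using S_nonempty[OF e(4)] by blast
      then show ?thesis
        using 2 next_neq[OF e(3)] by (intro sym satisfied_by[OF e(4)]) (auto dest!: sent_part)
    next
      case 3
      obtain i where "i \<in> S u"
        using S_nonempty[OF e(3)] by blast
      then show ?thesis
        using 3 next_neq[OF e(4)] by (intro satisfied_by[OF e(3)]) (auto dest!: sent_part)
    qed
  qed
  then have cf: "conflict_free G c"
    using edge unfolding conflict_free_def by metis
  let ?C = "insert 0 ((\<lambda>ji. Suc (prod_encode ji)) ` Sigma {..<3} (\<lambda>j. {..<P j}))"
  have "c e \<in> ?C" for e
  proof (cases "\<exists>ji. sent e ji")
    case True
    then obtain ji where ji: "sent e ji" by blast
    then have "ji \<in> Sigma {..<3} (\<lambda>j. {..<P j})"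
      using part S_palette by (auto simp: sent_def)
    moreover have "c e = Suc (prod_encode ji)"
      using ji c_sent by blast
    ultimately show ?thesis by blast
  next
    case False
    then show ?thesis
      unfolding c_def by (metis insertI1)
  qed
  then have "card (c ` ?E) \<le> card ?C"
    by (intro card_mono) auto
  also have "\<dots> \<le> Suc (card (Sigma {..<3::nat} (\<lambda>j. {..<P j})))"
    by (intro order_trans[OF card_insert_le_m1] order_trans[OF card_image_le]) 
       (auto simp: card_insert_if intro: card_image_le)
  also have "card (Sigma {..<3::nat} (\<lambda>j. {..<P j})) = (\<Sum>j<3. P j)"
    by (subst card_SigmaI) auto
  finally have "card (c ` ?E) \<le> Suc (\<Sum>j<3. P j)" .
  moreover have "cf_chromatic_index G \<le> card (c ` ?E)"
    unfolding cf_chromatic_index_def using cf by (intro Least_le) blast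
  ultimately show ?thesis by simp
qed

section \<open>Neighbourhoods in random graphs\<close>

text \<open>The two choices of \<open>h\<close> that matter are the indicator of failure, which gives the probability that no
coin in \<open>F\<close> succeeds, and \<open>h b = (if b then 2 else 1)\<close>, for which the product is 2 to the number of
successes and hence controls the upper tail.\<close>
lemma expectation_prod_independent_coins:
  fixes h :: "bool \<Rightarrow> real"
  assumes "finite A" and "F \<subseteq> A" and p: "0 \<le> p" "p \<le> 1" and "\<And>b. 0 \<le> h b"
  shows "measure_pmf.expectation (Pi_pmf A dflt (\<lambda>_. bernoulli_pmf p)) (\<lambda>X. \<Prod>e\<in>F. h (X e)) =
    (p * h True + (1 - p) * h False) ^ card F"
proof -
  have restrict: "(\<Prod>e\<in>A. if e \<in> F then k e else 1) = (\<Prod>e\<in>F. k e)" for k :: "'a \<Rightarrow> real"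
    using assms(1,2) by (simp add: prod.If_cases Int_absorb1)
  have "measure_pmf.expectation (Pi_pmf A dflt (\<lambda>_. bernoulli_pmf p)) (\<lambda>X. \<Prod>e\<in>F. h (X e)) =
    measure_pmf.expectation (Pi_pmf A dflt (\<lambda>_. bernoulli_pmf p))
      (\<lambda>X. \<Prod>e\<in>A. (\<lambda>e b. if e \<in> F then h b else 1) e (X e))"
    by (simp add: restrict)
  also have "\<dots> = (\<Prod>e\<in>A. measure_pmf.expectation (bernoulli_pmf p)
      ((\<lambda>e b. if e \<in> F then h b else 1) e))"
    using assms by (intro expectation_prod_Pi_pmf integrable_measure_pmf_finite) auto
  also have "\<dots> = (\<Prod>e\<in>A. if e \<in> F then p * h True + (1 - p) * h False else 1)"
    using p by (intro prod.cong) auto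
  also have "\<dots> = (p * h True + (1 - p) * h False) ^ card F"
    by (simp add: restrict)
  finally show ?thesis .
qed

lemma prob_no_success:
  assumes "finite A" and "F \<subseteq> A" and "0 \<le> p" "p \<le> 1"
  shows "measure_pmf.prob (Pi_pmf A dflt (\<lambda>_. bernoulli_pmf p)) {X. \<forall>e\<in>F. \<not> X e} =
    (1 - p) ^ card F"
proof -
  have "finite F"
    using assms by (auto intro: finite_subset)
  then have ind: "indicat_real {X. \<forall>e\<in>F. \<not> X e} = (\<lambda>X. \<Prod>e\<in>F. of_bool (\<not> X e))"
    by (auto simp: fun_eq_iff indicator_def prod_zero_iff)
  have "measure_pmf.prob (Pi_pmf A dflt (\<lambda>_. bernoulli_pmf p)) {X. \<forall>e\<in>F. \<not> X e} =
    measure_pmf.expectation (Pi_pmf A dflt (\<lambda>_. bernoulli_pmf p))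
      (\<lambda>X. \<Prod>e\<in>F. of_bool (\<not> X e))"
    unfolding ind[symmetric] by simp
  also have "\<dots> = (1 - p) ^ card F"
    using expectation_prod_independent_coins[OF assms, of "\<lambda>b. of_bool (\<not> b)" dflt] by simp
  finally show ?thesis .
qed

text \<open>Markov's inequality for 2 to the number of successes. It is wasteful near the mean, but only
thresholds well above the mean are needed.\<close>
lemma prob_many_successes:
  assumes "finite A" and "F \<subseteq> A" and p: "0 \<le> p" "p \<le> 1"
  shows "measure_pmf.prob (Pi_pmf A dflt (\<lambda>_. bernoulli_pmf p)) {X. d \<le> card {e \<in> F. X e}} \<le>
    (1 + p) ^ card F / 2 ^ d"
proof -
  let ?M = "Pi_pmf A dflt (\<lambda>_. bernoulli_pmf p)"
  have "finite F"
    using assms by (auto intro: finite_subset)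
  then have two_power: "(\<Prod>e\<in>F. if X e then 2 else 1) = (2::real) ^ card {e \<in> F. X e}" for X
    by (simp add: prod.If_cases Int_def)
  have fin: "finite (set_pmf ?M)"
    using assms(1) by (subst set_Pi_pmf) (auto intro!: finite_PiE_dflt)
  have "{X. d \<le> card {e \<in> F. X e}} =
      {X \<in> space ?M. (2::real) ^ d \<le> (\<Prod>e\<in>F. if X e then 2 else 1)}"
    by (auto simp: two_power)
  also have "measure_pmf.prob ?M \<dots> \<le>
      measure_pmf.expectation ?M (\<lambda>X. \<Prod>e\<in>F. if X e then 2 else 1) / 2 ^ d"
    by (intro integral_Markov_inequality_measure[where A = UNIV] integrable_measure_pmf_finite
          fin) (auto simp: two_power)
  also have "measure_pmf.expectation ?M (\<lambda>X. \<Prod>e\<in>F. if X e then 2 else 1) = (1 + p) ^ card F"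
    using expectation_prod_independent_coins[OF assms, of "\<lambda>b. if b then 2 else 1" dflt]
    by (simp add: add.commute)
  finally show ?thesis .
qed

lemma neighbours_random_graph:
  assumes "v \<in> {1..n}" and "B \<subseteq> {1..n}" and "v \<notin> B"
  shows "neighbours ({1..n}, {e \<in> all_edges {1..n}. X e}) v \<inter> B = {w \<in> B. X {v, w}}"
  using assms by (auto simp: neighbours_def all_edges_def card_2_iff doubleton_eq_iff)

text \<open>The events about the neighbours of \<open>v\<close> in \<open>B\<close> are events about independent coins, one for each
vertex of \<open>B\<close>.\<close>
lemma potential_edges:
  assumes "v \<in> {1..n}" and "B \<subseteq> {1..n}" and "v \<notin> B"
  shows "(\<lambda>w. {v, w}) ` B \<subseteq> all_edges {1..n}" and "inj_on (\<lambda>w. {v, w}) B"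
  using assms by (auto simp: all_edges_def card_2_iff doubleton_eq_iff inj_on_def)

lemma finite_all_edges: "finite V \<Longrightarrow> finite (all_edges V)"
  by (rule finite_subset[of _ "Pow V"]) (auto simp: all_edges_def)

lemma prob_no_neighbour:
  assumes "v \<in> {1..n}" and "B \<subseteq> {1..n}" and "v \<notin> B" and "0 \<le> p" "p \<le> 1"
  shows "measure_pmf.prob (random_graph n p) {G. neighbours G v \<inter> B = {}} = (1 - p) ^ card B"
proof -
  let ?F = "(\<lambda>w. {v, w}) ` B"
  have "measure_pmf.prob (random_graph n p) {G. neighbours G v \<inter> B = {}} =
    measure_pmf.prob (Pi_pmf (all_edges {1..n}) False (\<lambda>_. bernoulli_pmf p))
      {X. \<forall>e\<in>?F. \<not> X e}"
    unfolding random_graph_def measure_map_pmf vimage_def mem_Collect_eq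
    by (subst neighbours_random_graph[OF assms(1-3)])
      (rule arg_cong2[where f = measure, OF refl], auto)
  also have "\<dots> = (1 - p) ^ card ?F"
    using assms by (intro prob_no_success potential_edges finite_all_edges) auto
  also have "card ?F = card B"
    using potential_edges(2)[OF assms(1-3)] by (rule card_image)
  finally show ?thesis .
qed

lemma prob_many_neighbours:
  assumes "v \<in> {1..n}" and "B \<subseteq> {1..n}" and p: "0 \<le> p" "p \<le> 1"
  shows "measure_pmf.prob (random_graph n p) {G. d \<le> card (neighbours G v \<inter> B)} \<le>
    (1 + p) ^ card B / 2 ^ d"
proof -
  let ?B = "B - {v}"
  let ?F = "(\<lambda>w. {v, w}) ` ?B"
  have B: "?B \<subseteq> {1..n}" "v \<notin> ?B" "finite B"
    using assms by (auto intro: finite_subset)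
  have no_loop: "neighbours ({1..n}, {e \<in> all_edges {1..n}. X e}) v \<inter> B =
      neighbours ({1..n}, {e \<in> all_edges {1..n}. X e}) v \<inter> ?B" for X
    by (auto simp: neighbours_def all_edges_def)
  have card_F: "card {e \<in> ?F. X e} = card {w \<in> ?B. X {v, w}}" for X
  proof -
    have "{e \<in> ?F. X e} = (\<lambda>w. {v, w}) ` {w \<in> ?B. X {v, w}}"
      by auto
    moreover have "inj_on (\<lambda>w. {v, w}) {w \<in> ?B. X {v, w}}"
      using potential_edges(2)[OF assms(1) B(1,2)] by (rule inj_on_subset) auto
    ultimately show ?thesis
      by (simp add: card_image)
  qed
  have "measure_pmf.prob (random_graph n p) {G. d \<le> card (neighbours G v \<inter> B)} =
    measure_pmf.prob (Pi_pmf (all_edges {1..n}) False (\<lambda>_. bernoulli_pmf p))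
      {X. d \<le> card {e \<in> ?F. X e}}"
    unfolding random_graph_def measure_map_pmf vimage_def mem_Collect_eq no_loop card_F
    by (subst neighbours_random_graph[OF assms(1) B(1,2)]) auto
  also have "\<dots> \<le> (1 + p) ^ card ?F / 2 ^ d"
    using assms B by (intro prob_many_successes potential_edges finite_all_edges) auto
  also have "card ?F = card ?B"
    using potential_edges(2)[OF assms(1) B(1,2)] by (rule card_image)
  also have "(1 + p) ^ card ?B / 2 ^ d \<le> (1 + p) ^ card B / 2 ^ d"
    using B p by (intro divide_right_mono power_increasing card_mono) auto
  finally show ?thesis .
qed

text \<open>Asking for a neighbour in each of many disjoint blocks gives a lower bound on the number of
neighbours, in any union of blocks, from a union bound alone, without lower tail estimates.
The blocks start after 0 so that the first \<open>n div s\<close> of them lie inside \<open>{1..n}\<close>.\<close>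
definition block :: "nat \<Rightarrow> nat \<Rightarrow> nat set" where
  "block s j = {j * s<..j * s + s}"

definition hits_blocks :: "nat \<Rightarrow> nat \<Rightarrow> nat graph \<Rightarrow> bool" where
  "hits_blocks n s G \<longleftrightarrow>
    (\<forall>v\<in>{1..n}. \<forall>j<n div s. v \<notin> block s j \<longrightarrow> neighbours G v \<inter> block s j \<noteq> {})"

definition sparse_into :: "nat \<Rightarrow> nat \<Rightarrow> nat \<Rightarrow> nat graph \<Rightarrow> bool" where
  "sparse_into n m d G \<longleftrightarrow> (\<forall>v\<in>{1..n}. card (neighbours G v \<inter> {1..m}) < d)"

lemma block_subset: "j < n div s \<Longrightarrow> block s j \<subseteq> {1..n}"
proof -
  assume "j < n div s"
  then have "(j + 1) * s \<le> n div s * s"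
    by (intro mult_right_mono) auto
  also have "\<dots> \<le> n"
    by simp
  finally show ?thesis
    by (auto simp: block_def)
qed

lemma prob_not_hits_blocks:
  assumes "0 \<le> p" "p \<le> 1"
  shows "measure_pmf.prob (random_graph n p) {G. \<not> hits_blocks n s G} \<le>
    real n ^ 2 * exp (- p * real s)"
proof -
  let ?I = "{(v, j). v \<in> {1..n} \<and> j < n div s \<and> v \<notin> block s j}"
  have I: "?I \<subseteq> {1..n} \<times> {..<n div s}"
    by auto
  then have finI: "finite ?I"
    by (rule finite_subset) auto
  have "card ?I \<le> card ({1..n} \<times> {..<n div s})"
    using I by (intro card_mono) auto
  also have "\<dots> \<le> n * n"
    by (simp add: card_cartesian_product)
  finally have cardI: "real (card ?I) \<le> real n ^ 2"
    by (simp add: power2_eq_square flip: of_nat_mult)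
  have "{G. \<not> hits_blocks n s G} =
      (\<Union>(v, j)\<in>?I. {G. neighbours G v \<inter> block s j = {}})"
    unfolding hits_blocks_def by blast
  then have "measure_pmf.prob (random_graph n p) {G. \<not> hits_blocks n s G} \<le>
      (\<Sum>(v, j)\<in>?I. measure_pmf.prob (random_graph n p) {G. neighbours G v \<inter> block s j = {}})"
    using measure_UNION_le[OF finI, of "\<lambda>(v, j). {G. neighbours G v \<inter> block s j = {}}"
        "random_graph n p"] by (simp add: case_prod_unfold)
  also have "\<dots> \<le> real (card ?I) * exp (- p * real s)"
  proof (rule sum_bounded_above)
    fix vj assume "vj \<in> ?I"
    then obtain v j where vj: "vj = (v, j)" "v \<in> {1..n}" "j < n div s" "v \<notin> block s j"
      by auto
    have "measure_pmf.prob (random_graph n p) {G. neighbours G v \<inter> block s j = {}} = (1 - p) ^ s"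
      using prob_no_neighbour[OF vj(2) block_subset[OF vj(3)] vj(4) assms]
      by (simp add: block_def)
    also have "\<dots> \<le> exp (- p) ^ s"
      using assms exp_ge_add_one_self[of "- p"] by (intro power_mono) auto
    also have "\<dots> = exp (- p * real s)"
      by (rule exp_of_nat2_mult[symmetric])
    finally show "(case vj of (v, j) \<Rightarrow>
        measure_pmf.prob (random_graph n p) {G. neighbours G v \<inter> block s j = {}}) \<le>
        exp (- p * real s)"
      by (simp add: vj)
  qed
  also have "\<dots> \<le> real n ^ 2 * exp (- p * real s)"
    using cardI by (intro mult_right_mono) auto
  finally show ?thesis .
qed

lemma prob_not_sparse_into:
  assumes "0 \<le> p" "p \<le> 1" and "m \<le> n"
  shows "measure_pmf.prob (random_graph n p) {G. \<not> sparse_into n m d G} \<le>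
    real n * exp (p * real m) / 2 ^ d"
proof -
  have "{G. \<not> sparse_into n m d G} = (\<Union>v\<in>{1..n}. {G. d \<le> card (neighbours G v \<inter> {1..m})})"
    by (auto simp: sparse_into_def not_less)
  then have "measure_pmf.prob (random_graph n p) {G. \<not> sparse_into n m d G} \<le>
      (\<Sum>v\<in>{1..n}. measure_pmf.prob (random_graph n p) {G. d \<le> card (neighbours G v \<inter> {1..m})})"
    using measure_UNION_le[of "{1..n}" "\<lambda>v. {G. d \<le> card (neighbours G v \<inter> {1..m})}"
        "random_graph n p"] by simp
  also have "\<dots> \<le> real (card {1..n}) * (exp (p * real m) / 2 ^ d)"
  proof (rule sum_bounded_above)
    fix v assume "v \<in> {1..n}"
    then have "measure_pmf.prob (random_graph n p) {G. d \<le> card (neighbours G v \<inter> {1..m})} \<le>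
        (1 + p) ^ m / 2 ^ d"
      using prob_many_neighbours[of v n "{1..m}" p d] assms by simp
    also have "(1 + p) ^ m \<le> exp p ^ m"
      using assms exp_ge_add_one_self[of p] by (intro power_mono) auto
    also have "exp p ^ m = exp (p * real m)"
      by (rule exp_of_nat2_mult[symmetric])
    finally show "measure_pmf.prob (random_graph n p) {G. d \<le> card (neighbours G v \<inter> {1..m})} \<le>
        exp (p * real m) / 2 ^ d"
      by (simp add: divide_right_mono)
  qed
  finally show ?thesis
    by simp
qed

section \<open>Graphs in which every vertex reaches every block\<close>

lemma block_less: "w \<in> block s j \<Longrightarrow> a \<le> j \<Longrightarrow> a * s < w"
  unfolding block_def by (meson greaterThanAtMost_iff le_less_trans mult_le_mono1)

lemma block_le: "w \<in> block s j \<Longrightarrow> j < b \<Longrightarrow> w \<le> b * s"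
proof -
  assume "w \<in> block s j" "j < b"
  then have "w \<le> Suc j * s"
    by (simp add: block_def)
  also have "\<dots> \<le> b * s"
    using \<open>j < b\<close> by (intro mult_le_mono1) simp
  finally show ?thesis .
qed

lemma block_disjoint: "w \<in> block s i \<Longrightarrow> w \<in> block s j \<Longrightarrow> i = j"
  using block_less[of w s j "Suc i"] block_le[of w s i "Suc i"]
    block_less[of w s i "Suc j"] block_le[of w s j "Suc j"]
  by (metis Suc_leI lessI linorder_neqE_nat not_le)

text \<open>Every lower bound on a degree, and the targets required by the tripartition, come from this.\<close>
lemma card_blocks_le_neighbours:
  assumes hits: "hits_blocks n s G" and verts: "verts G = {1..n}" and v: "v \<in> {1..n}"
    and J: "J \<subseteq> {..<n div s}" and disj: "\<And>j. j \<in> J \<Longrightarrow> v \<notin> block s j"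
    and B: "\<And>j. j \<in> J \<Longrightarrow> block s j \<subseteq> B"
  shows "card J \<le> card (neighbours G v \<inter> B)"
proof -
  have "\<forall>j\<in>J. \<exists>w. w \<in> neighbours G v \<inter> block s j"
    using hits v J disj unfolding hits_blocks_def by blast
  from bchoice[OF this] obtain w where w: "\<forall>j\<in>J. w j \<in> neighbours G v \<inter> block s j"
    by (rule exE)
  show ?thesis
  proof (rule card_inj_on_le)
    show "inj_on w J"
      using w by (auto simp: inj_on_def intro: block_disjoint)
    show "w ` J \<subseteq> neighbours G v \<inter> B"
      using w B by blast
    show "finite (neighbours G v \<inter> B)"
      by (simp add: neighbours_def verts)
  qed
qed

text \<open>The first \<open>k\<close> blocks and the next \<open>k\<close> blocks are the two small parts, and everything else is the
large one. Vertices of the large part send edges into the first \<open>k\<close> blocks, these into the next \<open>k\<close>,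
and these back into the blocks \<open>2 * k, \<dots>, 3 * k - 1\<close>, which lie in the large part. The
palette of the large part has the least size \<open>k'\<close> that accommodates degree \<open>\<Delta>\<close>; the first
conjunct on \<open>k'\<close> says that it is at most \<open>log\<^sub>2 (\<Delta> + 1) + 1\<close>.\<close>
lemma cf_chromatic_index_le_of_hits_blocks:
  assumes simple: "simple_graph G" and verts: "verts G = {1..n}"
    and hits: "hits_blocks n s G" and sparse: "sparse_into n (2 * k * s) d G"
    and blocks: "3 * k \<le> n div s" and k: "n + 2 \<le> 2 ^ k" and l: "d < 2 ^ l" "l \<le> k"
  shows "no_isolated_vertices G" and "n div s \<le> Suc (max_degree G)"
    and "\<exists>k'. 2 ^ k' \<le> 2 * (max_degree G + 1) \<and> cf_chromatic_index G \<le> Suc (k' + 2 * l)"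
proof -
  have "k \<noteq> 0"
    using k by (cases k) auto
  with blocks have "3 \<le> n div s"
    by linarith
  then have "n \<noteq> 0"
    by (cases n) auto
  have finN: "finite (neighbours G v)" for v
    by (simp add: neighbours_def verts)
  \<comment> \<open>One block may be lost: the one that contains \<open>v\<close> itself.\<close>
  have degree: "n div s - 1 \<le> degree G v" if v: "v \<in> {1..n}" for v
  proof -
    let ?J = "{j. j < n div s \<and> v \<notin> block s j}"
    have "card {j. j < n div s \<and> v \<in> block s j} \<le> 1"
      using block_disjoint by (intro card_le_Suc0_iff_eq[THEN iffD2, folded One_nat_def]) auto
    moreover have "card {..<n div s} = card ?J + card {j. j < n div s \<and> v \<in> block s j}"
    proof -
      have "{..<n div s} = ?J \<union> {j. j < n div s \<and> v \<in> block s j}"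
        by auto
      then show ?thesis
        by (simp only:) (rule card_Un_disjoint, auto)
    qed
    ultimately have "n div s - 1 \<le> card ?J"
      by simp
    also have "\<dots> \<le> card (neighbours G v \<inter> UNIV)"
      by (rule card_blocks_le_neighbours[OF hits verts v]) auto
    finally show ?thesis
      by (simp add: degree_eq_card_neighbours[OF simple])
  qed
  have le_max: "degree G v \<le> max_degree G" if "v \<in> {1..n}" for v
    unfolding max_degree_def verts using that by (intro Max_ge) auto
  show "n div s \<le> Suc (max_degree G)"
    using degree[of 1] le_max[of 1] \<open>n \<noteq> 0\<close> by simp
  show "no_isolated_vertices G"
    unfolding no_isolated_vertices_def
  proof
    fix v assume "v \<in> verts G"
    then have "0 < degree G v"
      using degree[of v] \<open>3 \<le> n div s\<close> by (simp add: verts)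
    then show "incident_edges G v \<noteq> {}"
      by (auto simp: degree_def)
  qed
  have "max_degree G \<le> n"
    unfolding max_degree_def verts
  proof (rule Max.boundedI)
    fix x assume "x \<in> degree G ` {1..n}"
    then obtain v where "x = card (neighbours G v)"
      by (auto simp: degree_eq_card_neighbours[OF simple])
    also have "\<dots> \<le> card {1..n}"
      by (intro card_mono) (auto simp: neighbours_def verts)
    finally show "x \<le> n"
      by simp
  qed (use \<open>n \<noteq> 0\<close> in auto)
  define k' where "k' = (LEAST m. max_degree G + 2 \<le> 2 ^ m)"
  have "max_degree G + 2 \<le> 2 ^ k"
    using k \<open>max_degree G \<le> n\<close> by linarith
  then have k': "max_degree G + 2 \<le> 2 ^ k'" "k' \<le> k"
    unfolding k'_def by (rule LeastI) (rule Least_le, fact)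
  have "k' \<noteq> 0"
    using k' by (cases k') auto
  then obtain m where m: "k' = Suc m"
    by (cases k') auto
  then have "\<not> max_degree G + 2 \<le> 2 ^ m"
    unfolding k'_def by (intro not_less_Least) simp
  then have k'_upper: "2 ^ k' \<le> 2 * (max_degree G + 1)"
    by (simp add: m)
  define part where "part v = (if v \<le> k * s then 1 else if v \<le> 2 * k * s then 2 else 0 :: nat)"
    for v
  define P where "P j = (if j = 0 then k' else l)" for j :: nat
  have ks: "k * s \<le> 2 * k * s"
    by simp
  have "cf_chromatic_index G \<le> Suc (\<Sum>j<3. P j)"
  proof (rule cf_chromatic_index_le_cyclic_tripartition[OF simple])
    show "part v < 3" for v
      by (simp add: part_def)
    fix v assume "v \<in> verts G"
    then have v: "v \<in> {1..n}"
      by (simp add: verts)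
    have into: "card J \<le> card {w \<in> neighbours G v. part w = i}"
      if "J \<subseteq> {..<n div s}" "\<And>j w. j \<in> J \<Longrightarrow> w \<in> block s j \<Longrightarrow> part w = i" "part v \<noteq> i" for J i
    proof -
      have "card J \<le> card (neighbours G v \<inter> {w. part w = i})"
        using that by (intro card_blocks_le_neighbours[OF hits verts v]) auto
      then show ?thesis
        by (simp add: Int_def)
    qed
    have "part v = 0 \<or> part v = 1 \<or> part v = 2"
      by (simp add: part_def)
    then consider "part v = 0" | "part v = 1" | "part v = 2"
      by (elim disjE) auto
    then show "P (part v) \<le> card {w \<in> neighbours G v. part w = Suc (part v) mod 3}"
    proof cases
      case 1
      have "card {..<k} \<le> card {w \<in> neighbours G v. part w = 1}"
        using blocks block_le[of _ s _ k] 1 by (intro into) (auto simp: part_def)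
      then show ?thesis
        using 1 k' by (simp add: P_def)
    next
      case 2
      have "card {k..<2 * k} \<le> card {w \<in> neighbours G v. part w = 2}"
        using blocks block_less[of _ s _ k] block_le[of _ s _ "2 * k"] 2
        by (intro into) (fastforce simp: part_def)+
      then show ?thesis
        using 2 l by (simp add: P_def numeral_2_eq_2)
    next
      case 3
      have "card {2 * k..<3 * k} \<le> card {w \<in> neighbours G v. part w = 0}"
        using blocks block_less[of _ s _ "2 * k"] ks 3
        by (intro into) (fastforce simp: part_def)+
      then show ?thesis
        using 3 l by (simp add: P_def)
    qed
    show "card {w \<in> neighbours G v. part w = part v} < 2 ^ P (part v) - 1"
    proof (cases "part v = 0")
      case True
      have "card {w \<in> neighbours G v. part w = part v} \<le> degree G v"
        unfolding degree_eq_card_neighbours[OF simple] using finN by (intro card_mono) auto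
      also have "\<dots> \<le> max_degree G"
        using v by (rule le_max)
      also have "\<dots> < 2 ^ P (part v) - 1"
        using k' True by (simp add: P_def)
      finally show ?thesis .
    next
      case False
      have "w \<le> 2 * k * s" if "part w = part v" for w
        using that False ks by (auto simp: part_def split: if_splits)
      then have "card {w \<in> neighbours G v. part w = part v} \<le>
          card (neighbours G v \<inter> {1..2 * k * s})"
        using finN by (intro card_mono) (auto simp: neighbours_def verts)
      also have "\<dots> < d"
        using sparse v by (simp add: sparse_into_def)
      also have "\<dots> \<le> 2 ^ P (part v) - 1"
        using l False by (simp add: P_def)
      finally show ?thesis .
    qed
  qed
  also have "(\<Sum>j<3. P j) = k' + 2 * l"
    by (simp add: P_def numeral_3_eq_3)
  finally show "\<exists>k'. 2 ^ k' \<le> 2 * (max_degree G + 1) \<and> cf_chromatic_index G \<le> Suc (k' + 2 * l)"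
    using k'_upper by blast
qed

section \<open>Asymptotics\<close>

text \<open>In the estimates below, \<open>log 2 n + 2\<close> is an upper bound for the number of blocks in a small part, and
\<open>n powr \<delta> / (4 * (log 2 n + 2)) - 1\<close> is a lower bound for the total number of blocks.\<close>
lemma growth_small_palette: "eventually (\<lambda>n::nat.
    log 2 (18 * (log 2 n + 2)^2 + 1) + 1 \<le> log 2 n) sequentially"
  by real_asymp

lemma
  fixes \<delta> :: real
  assumes "0 < \<delta>"
  shows growth_blocks: "eventually (\<lambda>n::nat.
      3 * (log 2 n + 2) \<le> real n powr \<delta> / (4 * (log 2 n + 2)) - 1) sequentially"
    and growth_degree: "eventually (\<lambda>n::nat.
      real n powr (\<delta> / 2) \<le> real n powr \<delta> / (4 * (log 2 n + 2)) - 2) sequentially"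
    and growth_total: "eventually (\<lambda>n::nat.
      2 * (log 2 (18 * (log 2 n + 2)^2 + 1) + 1) + 3 \<le> 5 * log 2 (\<delta> / 2 * log 2 n)) sequentially"
  using assms by real_asymp+

text \<open>Since \<open>n \<le> exp k\<close>, blocks with \<open>p s \<ge> 3 k\<close> beat the at most \<open>n\<^sup>2\<close> pairs of a vertex and a block. The
expected degree into the two small parts is at most \<open>8 k\<^sup>2\<close>, and \<open>exp (8 k\<^sup>2) \<le> 2 ^ (16 k\<^sup>2)\<close>, so the
threshold \<open>18 k\<^sup>2\<close> leaves a factor \<open>2 ^ (2 k\<^sup>2) \<ge> n\<^sup>2\<close> against the \<open>n\<close> vertices.\<close>
lemma prob_not_hits_or_not_sparse:
  fixes p :: real
  assumes p: "0 \<le> p" "p \<le> 1" and n: "0 < n" "n + 2 \<le> 2 ^ k"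
    and s: "3 * real k \<le> p * real s" "p * real s \<le> 4 * real k" and m: "2 * k * s \<le> n"
  shows "measure_pmf.prob (random_graph n p)
    {G. \<not> (hits_blocks n s G \<and> sparse_into n (2 * k * s) (18 * k ^ 2) G)} \<le> 2 / real n"
proof -
  have k: "1 \<le> k"
    using n by (cases k) auto
  have "real n \<le> real (2 ^ k)"
    using n(2) by (intro of_nat_mono) linarith
  then have n_le: "real n \<le> 2 ^ k"
    by simp
  have "(2::real) ^ k \<le> exp 1 ^ k"
    using exp_ge_add_one_self[of 1] by (intro power_mono) auto
  also have "exp 1 ^ k = exp (real k)"
    using exp_of_nat2_mult[of "1::real" k] by simp
  finally have n_le_exp: "real n \<le> exp (real k)"
    by (rule order_trans[OF n_le])
  have "real n ^ 2 * exp (- p * real s) \<le> real n ^ 2 * exp (- (real k * real 3))"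
    using s(1) by (intro mult_left_mono) auto
  also have "\<dots> = real n ^ 2 / exp (real k) ^ 3"
    by (simp only: exp_minus exp_of_nat2_mult divide_inverse)
  also have "\<dots> \<le> real n ^ 2 / real n ^ 3"
    using n_le_exp n(1) by (intro divide_left_mono power_mono mult_pos_pos) auto
  also have "\<dots> = 1 / real n"
    using n(1) by (simp add: power2_eq_square power3_eq_cube)
  finally have hits: "measure_pmf.prob (random_graph n p) {G. \<not> hits_blocks n s G} \<le> 1 / real n"
    using prob_not_hits_blocks[OF p, of n s] by linarith
  have split_power: "(2::real) ^ (18 * k ^ 2) = 2 ^ (16 * k ^ 2) * 2 ^ (2 * k ^ 2)"
    by (simp flip: power_add)
  have "p * real (2 * k * s) = 2 * real k * (p * real s)"
    by simp
  also have "\<dots> \<le> 2 * real k * (4 * real k)"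
    using s(2) by (intro mult_left_mono) auto
  also have "\<dots> = 1 * real (8 * k ^ 2)"
    by (simp add: power2_eq_square)
  finally have "exp (p * real (2 * k * s)) \<le> exp (1 * real (8 * k ^ 2))"
    by simp
  also have "\<dots> = exp 1 ^ (8 * k ^ 2)"
    by (rule exp_of_nat2_mult)
  also have "\<dots> \<le> (2 ^ 2) ^ (8 * k ^ 2)"
    using exp_le by (intro power_mono) auto
  also have "\<dots> = (2::real) ^ (16 * k ^ 2)"
    unfolding power_mult[symmetric] by simp
  finally have "real n * exp (p * real (2 * k * s)) / 2 ^ (18 * k ^ 2) \<le>
      real n * 2 ^ (16 * k ^ 2) / 2 ^ (18 * k ^ 2)"
    by (intro divide_right_mono mult_left_mono) auto
  also have "real n * 2 ^ (16 * k ^ 2) / 2 ^ (18 * k ^ 2) = real n / 2 ^ (2 * k ^ 2)"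
    unfolding split_power by simp
  also have "\<dots> \<le> real n / real n ^ 2"
  proof (intro divide_left_mono mult_pos_pos)
    have "real n ^ 2 \<le> (2 ^ k) ^ 2"
      using n_le by (intro power_mono) auto
    also have "\<dots> = (2::real) ^ (2 * k)"
      by (simp add: power_mult[symmetric] mult.commute)
    also have "\<dots> \<le> 2 ^ (2 * k ^ 2)"
      using k by (intro power_increasing) (auto simp: power2_eq_square)
    finally show "real n ^ 2 \<le> 2 ^ (2 * k ^ 2)" .
  qed (use n(1) in auto)
  also have "\<dots> = 1 / real n"
    using n(1) by (simp add: power2_eq_square)
  finally have sparse: "measure_pmf.prob (random_graph n p)
      {G. \<not> sparse_into n (2 * k * s) (18 * k ^ 2) G} \<le> 1 / real n"
    using prob_not_sparse_into[OF p m, of "18 * k ^ 2"] by linarith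
  have "{G. \<not> (hits_blocks n s G \<and> sparse_into n (2 * k * s) (18 * k ^ 2) G)} =
      {G. \<not> hits_blocks n s G} \<union> {G. \<not> sparse_into n (2 * k * s) (18 * k ^ 2) G}"
    by blast
  also have "measure_pmf.prob (random_graph n p) \<dots> \<le>
      measure_pmf.prob (random_graph n p) {G. \<not> hits_blocks n s G} +
      measure_pmf.prob (random_graph n p) {G. \<not> sparse_into n (2 * k * s) (18 * k ^ 2) G}"
    by (rule measure_Un_le) auto
  also have "\<dots> \<le> 2 / real n"
    using hits sparse by simp
  finally show ?thesis .
qed

text \<open>The lower bound on \<open>\<Delta>\<close> is kept in the event, because it is what turns the error term
\<open>log\<^sub>2 (log\<^sub>2 \<Delta>)\<close> into \<open>o(log\<^sub>2 \<Delta>)\<close> uniformly over the graphs in the event.\<close>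
lemma eventually_prob_bounds:
  fixes \<epsilon> :: real and p :: "nat \<Rightarrow> real"
  assumes \<epsilon>: "\<epsilon> < 1" and p01: "\<And>n. 0 \<le> p n \<and> p n \<le> 1"
    and p_large: "filterlim (\<lambda>n. p n * real n powr \<epsilon>) at_top sequentially"
  shows "eventually (\<lambda>n. 1 - 2 / real n \<le> measure_pmf.prob (random_graph n (p n))
    {G. no_isolated_vertices G \<and>
        real (cf_chromatic_index G) \<le>
          log 2 (real (max_degree G)) + 5 * log 2 (log 2 (real (max_degree G))) \<and>
        (1 - \<epsilon>) / 2 * log 2 (real n) \<le> log 2 (real (max_degree G))}) sequentially"
proof -
  define \<delta> where "\<delta> = 1 - \<epsilon>"
  have \<delta>: "0 < \<delta>"
    using \<epsilon> by (simp add: \<delta>_def)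
  have "eventually (\<lambda>n. 1 \<le> p n * real n powr \<epsilon>) sequentially"
    using p_large by (simp add: filterlim_at_top)
  then show ?thesis
    using eventually_ge_at_top[of 2] growth_blocks[OF \<delta>] growth_degree[OF \<delta>]
      growth_small_palette growth_total[OF \<delta>]
  proof eventually_elim
    case (elim n)
    let ?L = "log 2 (real n)" and ?p = "p n"
    have n: "2 \<le> n"
      by fact
    have L: "1 \<le> ?L"
      using n by (simp add: le_log_iff)
    have p_pos: "0 < ?p"
      using elim(1) p01[of n] by (cases "?p = 0") auto
    \<comment> \<open>The palette of the large part needs \<open>\<Delta> + 2\<close> subsets, the empty one included, and \<open>\<Delta>\<close> is
      bounded by \<open>n\<close> only.\<close>
    define k where "k = nat \<lceil>log 2 (real n + 2)\<rceil>"
    have k_log: "log 2 (real n + 2) \<le> real k" "real k \<le> log 2 (real n + 2) + 1"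
      using n by (auto simp: k_def intro!: real_nat_ceiling_ge)
    have "log 2 (real n + 2) \<le> log 2 (2 * real n)"
      using n by (intro log_mono) auto
    also have "\<dots> = ?L + 1"
      using n by (simp add: log_mult)
    finally have k_upper: "real k \<le> ?L + 2"
      using k_log by linarith
    have k_lower: "?L \<le> real k"
      using n by (intro order_trans[OF log_mono k_log(1)]) auto
    have "real n + 2 \<le> 2 powr real k"
      using k_log(1) n by (simp add: log_le_iff)
    then have "real (n + 2) \<le> real (2 ^ k)"
      by (simp add: powr_realpow)
    then have k_pow: "n + 2 \<le> 2 ^ k"
      by (simp only: of_nat_le_iff)
    have k1: "1 \<le> real k"
      using k_lower L by linarith
    define s where "s = nat \<lceil>3 * real k / ?p\<rceil>"
    have s_ge: "3 * real k / ?p \<le> real s"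
      unfolding s_def by (rule real_nat_ceiling_ge)
    have "real s \<le> 3 * real k / ?p + 1"
    proof -
      have "0 \<le> 3 * real k / ?p"
        using p_pos by simp
      then show ?thesis
        unfolding s_def by linarith
    qed
    also have "1 \<le> real k / ?p"
      using p_pos p01[of n] k1 by (simp add: field_simps)
    finally have s_le: "real s \<le> 4 * real k / ?p"
      by (simp add: add_divide_distrib[symmetric])
    have ps: "3 * real k \<le> ?p * real s" "?p * real s \<le> 4 * real k"
      using s_ge s_le p_pos by (simp_all add: field_simps)
    have s_pos: "0 < real s"
      using s_ge k1 p_pos by (smt (verit) divide_pos_pos)
    have "real n powr \<delta> = real n / real n powr \<epsilon>"
      using n by (simp add: \<delta>_def powr_diff)
    also have "\<dots> \<le> real n * ?p"
      using elim(1) n by (simp add: field_simps)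
    finally have np: "real n powr \<delta> \<le> real n * ?p" .
    have "real n powr \<delta> / (4 * (?L + 2)) \<le> real n * ?p / (4 * real k)"
      using np k_upper k1 n p01[of n] by (intro frac_le) auto
    also have "\<dots> \<le> real n / real s"
      using mult_left_mono[OF ps(2), of "real n"] s_pos k1 by (simp add: field_simps)
    also have "\<dots> \<le> real (n div s) + 1"
      using floor_divide_of_nat_eq[of n s, where ?'a = real] by linarith
    finally have blocks_ge: "real n powr \<delta> / (4 * (?L + 2)) - 1 \<le> real (n div s)"
      by simp
    have "real (3 * k) \<le> real (n div s)"
      using blocks_ge elim(3) k_upper by simp
    then have blocks: "3 * k \<le> n div s"
      by (simp only: of_nat_le_iff)
    have "2 * k * s \<le> n div s * s"
      using blocks by (intro mult_le_mono1) simp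
    also have "\<dots> \<le> n"
      by simp
    finally have m: "2 * k * s \<le> n" .
    define l where "l = nat \<lceil>log 2 (18 * real k ^ 2 + 1)\<rceil>"
    have l_ge: "log 2 (18 * real k ^ 2 + 1) \<le> real l"
      unfolding l_def by (rule real_nat_ceiling_ge)
    have "real l \<le> log 2 (18 * real k ^ 2 + 1) + 1"
    proof -
      have "0 \<le> log 2 (18 * real k ^ 2 + 1)"
        by (subst zero_le_log_cancel_iff) (simp_all add: add_nonneg_pos)
      then show ?thesis
        unfolding l_def by linarith
    qed
    also have "log 2 (18 * real k ^ 2 + 1) \<le> log 2 (18 * (?L + 2) ^ 2 + 1)"
      using k_upper by (intro log_mono add_mono mult_left_mono power_mono) (auto intro: add_nonneg_pos)
    finally have l_le: "real l \<le> log 2 (18 * (?L + 2) ^ 2 + 1) + 1"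
      by simp
    have "real l \<le> real k"
      using l_le elim(5) k_lower by linarith
    then have lk: "l \<le> k"
      by (simp only: of_nat_le_iff)
    have "18 * real k ^ 2 + 1 \<le> 2 powr real l"
      using l_ge by (simp add: log_le_iff add_nonneg_pos)
    then have "real (18 * k ^ 2 + 1) \<le> real (2 ^ l)"
      by (simp add: powr_realpow)
    then have "18 * k ^ 2 + 1 \<le> 2 ^ l"
      by (simp only: of_nat_le_iff)
    then have l_pow: "18 * k ^ 2 < 2 ^ l"
      by simp
    let ?T = "{G. no_isolated_vertices G \<and>
        real (cf_chromatic_index G) \<le>
          log 2 (real (max_degree G)) + 5 * log 2 (log 2 (real (max_degree G))) \<and>
        (1 - \<epsilon>) / 2 * ?L \<le> log 2 (real (max_degree G))}"
    let ?Bad = "{G. \<not> (hits_blocks n s G \<and> sparse_into n (2 * k * s) (18 * k ^ 2) G)}"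
    have good: "G \<in> ?T" if G: "G \<in> set_pmf (random_graph n ?p)" "G \<notin> ?Bad" for G
    proof -
      let ?D = "max_degree G"
      have simple: "simple_graph G" and verts: "verts G = {1..n}"
        using simple_graph_random_graph[OF G(1)] G(1) by (auto simp: random_graph_def)
      have "hits_blocks n s G" "sparse_into n (2 * k * s) (18 * k ^ 2) G"
        using G(2) by auto
      note bounds = cf_chromatic_index_le_of_hits_blocks
        [OF simple verts this blocks k_pow l_pow lk]
      from bounds(3) obtain k' where k': "2 ^ k' \<le> 2 * (?D + 1)"
        "cf_chromatic_index G \<le> Suc (k' + 2 * l)"
        by (elim exE conjE) (rule that)
      have "real (n div s) \<le> real (Suc ?D)"
        using bounds(2) by (simp only: of_nat_le_iff)
      then have D_powr: "real n powr (\<delta> / 2) \<le> real ?D"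
        using blocks_ge elim(4) by simp
      moreover have "1 \<le> real n powr (\<delta> / 2)"
        using n \<delta> by (intro ge_one_powr_ge_zero) auto
      ultimately have D1: "1 \<le> real ?D"
        by linarith
      have "log 2 (real n powr (\<delta> / 2)) \<le> log 2 (real ?D)"
        using D_powr n by (intro log_mono) auto
      then have log_D: "\<delta> / 2 * ?L \<le> log 2 (real ?D)"
        using n by (simp add: log_powr)
      have "real (2 ^ k') \<le> real (2 * (?D + 1))"
        using k'(1) by (simp only: of_nat_le_iff)
      then have "2 powr real k' \<le> 4 * real ?D"
        using D1 by (simp add: powr_realpow)
      then have "real k' \<le> log 2 (4 * real ?D)"
        using D1 by (simp add: le_log_iff)
      also have "\<dots> = log 2 (2 ^ 2) + log 2 (real ?D)"
        using D1 log_mult[of 2 "2 ^ 2" "real ?D"] by simp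
      also have "log 2 (2 ^ 2 :: real) = 2"
        by (subst log_nat_power) auto
      finally have "real k' \<le> 2 + log 2 (real ?D)" .
      moreover have "real (cf_chromatic_index G) \<le> real (Suc (k' + 2 * l))"
        using k'(2) by (simp only: of_nat_le_iff)
      moreover have "5 * log 2 (\<delta> / 2 * ?L) \<le> 5 * log 2 (log 2 (real ?D))"
        using log_D \<delta> L by (intro mult_left_mono log_mono) auto
      ultimately have "real (cf_chromatic_index G) \<le>
          log 2 (real ?D) + 5 * log 2 (log 2 (real ?D))"
        using l_le elim(6) by simp
      then show "G \<in> ?T"
        using bounds(1) log_D by (simp add: \<delta>_def)
    qed
    have "1 - 2 / real n \<le> 1 - measure_pmf.prob (random_graph n ?p) ?Bad"
      using prob_not_hits_or_not_sparse[OF _ _ _ k_pow ps m] p01[of n] n by simp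
    also have "\<dots> = measure_pmf.prob (random_graph n ?p) (- ?Bad)"
      using measure_pmf.prob_compl[of ?Bad "random_graph n ?p"] by (simp add: Compl_eq_Diff_UNIV)
    also have "\<dots> \<le> measure_pmf.prob (random_graph n ?p) ?T"
      using good by (intro measure_pmf.finite_measure_mono_AE AE_pmfI) auto
    finally show ?case .
  qed
qed

theorem corollary12:
  fixes \<epsilon> :: real and p :: "nat \<Rightarrow> real"
  assumes "0 < \<epsilon>" and "\<epsilon> < 1"
    and "\<And>n. 0 \<le> p n \<and> p n \<le> 1"
    and "filterlim (\<lambda>n. p n * real n powr \<epsilon>) at_top sequentially"
  shows "(\<exists>C::real.
            (\<lambda>n. measure_pmf.prob (random_graph n (p n))
                   {G. no_isolated_vertices G \<and>
                       real (cf_chromatic_index G)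
                         \<le> log 2 (real (max_degree G))
                            + C * log 2 (log 2 (real (max_degree G)))})
              \<longlonglongrightarrow> 1) \<and>
         (\<forall>\<eta>::real. \<eta> > 0 \<longrightarrow>
            (\<lambda>n. measure_pmf.prob (random_graph n (p n))
                   {G. no_isolated_vertices G \<and>
                       real (cf_chromatic_index G)
                         \<le> (1 + \<eta>) * log 2 (real (max_degree G))})
              \<longlonglongrightarrow> 1)"
proof -
  let ?M = "\<lambda>n. measure_pmf (random_graph n (p n))"
  let ?\<Delta> = "\<lambda>G::nat graph. real (max_degree G)"
  let ?T = "\<lambda>n. {G. no_isolated_vertices G \<and>
        real (cf_chromatic_index G) \<le> log 2 (?\<Delta> G) + 5 * log 2 (log 2 (?\<Delta> G)) \<and>
        (1 - \<epsilon>) / 2 * log 2 (real n) \<le> log 2 (?\<Delta> G)}"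
  have whp: "eventually (\<lambda>n. 1 - 2 / real n \<le> measure (?M n) (?T n)) sequentially"
    using assms(2-4) by (rule eventually_prob_bounds)
  have tends: "(\<lambda>n. measure (?M n) S) \<longlonglongrightarrow> 1"
    if "eventually (\<lambda>n. ?T n \<subseteq> S) sequentially" for S
  proof (rule tendsto_sandwich)
    show "eventually (\<lambda>n. 1 - 2 / real n \<le> measure (?M n) S) sequentially"
      using whp that
    proof eventually_elim
      case (elim n)
      then show ?case
        using measure_pmf.finite_measure_mono[of "?T n" S "random_graph n (p n)"] by simp
    qed
    show "(\<lambda>n. 1 - 2 / real n) \<longlonglongrightarrow> 1"
      by real_asymp
  qed auto
  have "(\<lambda>n. measure (?M n) {G. no_isolated_vertices G \<and>
      real (cf_chromatic_index G) \<le> (1 + \<eta>) * log 2 (?\<Delta> G)}) \<longlonglongrightarrow> 1" if "0 < \<eta>" for \<eta> :: real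
  proof (rule tends)
    have "eventually (\<lambda>x::real. 5 * log 2 x \<le> \<eta> * x) at_top"
      using that by real_asymp
    then obtain x0 where x0: "\<And>x. x0 \<le> x \<Longrightarrow> 5 * log 2 x \<le> \<eta> * x"
      by (auto simp: eventually_at_top_linorder)
    have "eventually (\<lambda>n. x0 \<le> (1 - \<epsilon>) / 2 * log 2 (real n)) sequentially"
      using assms(2) by real_asymp
    then show "eventually (\<lambda>n. ?T n \<subseteq> {G. no_isolated_vertices G \<and>
        real (cf_chromatic_index G) \<le> (1 + \<eta>) * log 2 (?\<Delta> G)}) sequentially"
    proof eventually_elim
      case (elim n)
      have "log 2 x + 5 * log 2 (log 2 x) \<le> (1 + \<eta>) * log 2 x"
        if "(1 - \<epsilon>) / 2 * log 2 (real n) \<le> log 2 x" for x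
        using x0[of "log 2 x"] elim that by (simp add: algebra_simps)
      then show ?case
        by fastforce
    qed
  qed
  moreover have "(\<lambda>n. measure (?M n) {G. no_isolated_vertices G \<and>
      real (cf_chromatic_index G) \<le> log 2 (?\<Delta> G) + 5 * log 2 (log 2 (?\<Delta> G))}) \<longlonglongrightarrow> 1"
    by (rule tends) (intro always_eventually allI, blast)
  ultimately show ?thesis
    by blast
qed

end
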